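(* Let $X$ be a topological space and let $X'\subseteq X$ be a subspace such that there is a retraction $r:X\to X'$ (a continuous map with $r|_{X'}=\mathrm{id}_{X'}$). Then $\operatorname{cat}(X')\le\operatorname{cat}(X)$.
   Context: All maps are continuous and all spaces are normal topological spaces. The Lusternik-Schnirelmann category $\operatorname{cat}(X)$ of a space $X$ is the minimal number $n$ such that $X$ admits an open cover by $n+1$ open sets $U_0,U_1,\dots,U_n$ each of which is contractible in $X$ (that is, the inclusion $U_i\hookrightarrow X$ is null-homotopic); $\operatorname{cat}(X)=\infty$ if no such $n$ exists. *)

theory Defs
  imports "HOL-Analysis.Analysis"
begin

text \<open>As in the library's \<^const>\<open>contractible_space\<close>, the constant map is not required to take its value in
  the space; this matters only for the empty space, which thereby is contractible in itself and has category 0.\<close>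

definition contractible_in :: "'a topology \<Rightarrow> 'a set \<Rightarrow> bool" where
  "contractible_in X U \<longleftrightarrow>
    U \<subseteq> topspace X \<and>
    (\<exists>a. homotopic_with (\<lambda>h. True) (subtopology X U) X id (\<lambda>x. a))"

definition has_categorical_cover :: "'a topology \<Rightarrow> nat \<Rightarrow> bool" where
  "has_categorical_cover X n \<longleftrightarrow>
    (\<exists>U :: nat \<Rightarrow> 'a set.
      (\<forall>i\<le>n. openin X (U i) \<and> contractible_in X (U i)) \<and>
      (\<Union>i\<le>n. U i) = topspace X)"

text \<open>Lusternik-Schnirelmann category, normalized so that contractible spaces have category 0.
  The infimum of the empty set in \<^typ>\<open>enat\<close> is \<open>\<infinity>\<close>.\<close>

definition ls_cat :: "'a topology \<Rightarrow> enat" where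
  "ls_cat X = Inf {enat n |n. has_categorical_cover X n}"

end

theory Submission
  imports Defs
begin

text \<open>Let \<open>r\<close> be the retraction onto \<open>X'\<close>. The traces \<open>U i \<inter> X'\<close> of a categorical open cover of \<open>X\<close>
  form an open cover of \<open>X'\<close> with the same index set. If \<open>H\<close> deforms the inclusion of \<open>U i\<close>
  into \<open>X\<close> to a constant map, then \<open>H\<close> moves the points of \<open>U i \<inter> X'\<close> through \<open>X\<close>, possibly outside
  \<open>X'\<close>, but \<open>r \<circ> H\<close> moves them within \<open>X'\<close>: it still starts at the inclusion, as \<open>r\<close> fixes \<open>X'\<close>
  pointwise, and it still ends at a constant. Hence every categorical cover of \<open>X\<close> yields one of
  the same length for \<open>X'\<close>, and the infimum for \<open>X'\<close> is taken over a larger set.\<close>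

text \<open>Composing with \<open>r\<close> is what brings the contraction back into \<open>S\<close>; restricting the homotopy alone
  would only show that \<open>U \<inter> S\<close> is contractible in \<open>X\<close>.\<close>

lemma contractible_in_retract:
  assumes "contractible_in X U"
    and r: "continuous_map X (subtopology X S) r" and fix_r: "\<And>x. x \<in> S \<Longrightarrow> r x = x"
  shows "contractible_in (subtopology X S) (U \<inter> S)"
proof -
  obtain a where "U \<subseteq> topspace X"
    and "homotopic_with (\<lambda>h. True) (subtopology X U) X id (\<lambda>x. a)"
    using assms(1) unfolding contractible_in_def by blast
  then have "homotopic_with (\<lambda>h. True) (subtopology X U) (subtopology X S) (r \<circ> id) (r \<circ> (\<lambda>x. a))"
    using r by (intro homotopic_with_compose_continuous_map_left) auto
  then have "homotopic_with (\<lambda>h. True) (subtopology (subtopology X U) S) (subtopology X S)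
      (r \<circ> id) (r \<circ> (\<lambda>x. a))"
    by (rule homotopic_from_subtopology)
  then have "homotopic_with (\<lambda>h. True) (subtopology (subtopology X S) (U \<inter> S)) (subtopology X S)
      (r \<circ> id) (r \<circ> (\<lambda>x. a))"
    by (simp add: subtopology_subtopology Int_ac)
  \<comment> \<open>Homotopic maps may be changed off the domain, and \<open>r\<close> agrees with \<open>id\<close> on \<open>U \<inter> S\<close>.\<close>
  then have "homotopic_with (\<lambda>h. True) (subtopology (subtopology X S) (U \<inter> S)) (subtopology X S)
      id (\<lambda>x. r a)"
    by (rule homotopic_with_eq) (auto simp: fix_r)
  with \<open>U \<subseteq> topspace X\<close> show ?thesis
    unfolding contractible_in_def by auto
qed

lemma has_categorical_cover_retract:
  assumes "S retract_of_space X" and "has_categorical_cover X n"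
  shows "has_categorical_cover (subtopology X S) n"
proof -
  obtain r where r: "continuous_map X (subtopology X S) r" "\<And>x. x \<in> S \<Longrightarrow> r x = x"
    using assms(1) unfolding retract_of_space_def by blast
  obtain U where U: "\<And>i. i \<le> n \<Longrightarrow> openin X (U i)" "\<And>i. i \<le> n \<Longrightarrow> contractible_in X (U i)"
    and cover: "(\<Union>i\<le>n. U i) = topspace X"
    using assms(2) unfolding has_categorical_cover_def by blast
  have "openin (subtopology X S) (U i \<inter> S)" if "i \<le> n" for i
    using U(1)[OF that] by (auto simp: openin_subtopology)
  moreover have "contractible_in (subtopology X S) (U i \<inter> S)" if "i \<le> n" for i
    using U(2)[OF that] r by (rule contractible_in_retract)
  moreover have "(\<Union>i\<le>n. U i \<inter> S) = topspace (subtopology X S)"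
    using cover by auto
  ultimately show ?thesis
    unfolding has_categorical_cover_def by (intro exI[of _ "\<lambda>i. U i \<inter> S"]) blast
qed

theorem lemma4p1:
  fixes X :: "'a topology" and X' :: "'a set"
  assumes "normal_space X"
    and "X' retract_of_space X"
  shows "ls_cat (subtopology X X') \<le> ls_cat X"
  unfolding ls_cat_def
  using has_categorical_cover_retract[OF assms(2)] by (intro Inf_superset_mono) blast

end
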